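(* Let $n\ge 1$, let $l=\lfloor n/2\rfloor$, let $J_n$ be an $n\times n$ complex irreducible tridiagonal matrix with zero main diagonal, with subdiagonal entries $a_1,\dots,a_{n-1}\in\mathbb{C}\setminus\{0\}$ and superdiagonal entries $c_1,\dots,c_{n-1}\in\mathbb{C}\setminus\{0\}$. Let $x\in\mathbb{C}\setminus\{0\}$ and $A_n=J_n+xE_n$, where $E_n=\mathrm{diag}(1,-1,1,\dots,(-1)^{n-1})$. Let $\lambda_1,\dots,\lambda_l\in\mathbb{C}$ be such that, as multisets (eigenvalues listed with algebraic multiplicity), $\sigma(J_n)=\{\pm\lambda_1,\dots,\pm\lambda_l\}$ if $n=2l$, and $\sigma(J_n)=\{0,\pm\lambda_1,\dots,\pm\lambda_l\}$ if $n=2l+1$. Then, as multisets (eigenvalues listed with algebraic multiplicity), $$\sigma(A_{2l})=\left\{\pm\sqrt{\lambda_1^2+x^2},\ \pm\sqrt{\lambda_2^2+x^2},\ \ldots,\ \pm\sqrt{\lambda_l^2+x^2}\right\}\quad\text{if } n=2l,$$ and $$\sigma(A_{2l+1})=\left\{x,\ \pm\sqrt{\lambda_1^2+x^2},\ \pm\sqrt{\lambda_2^2+x^2},\ \ldots,\ \pm\sqrt{\lambda_l^2+x^2}\right\}\quad\text{if } n=2l+1.$$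
   Context: $J_n$ has entries $(J_n)_{k+1,k}=a_k$, $(J_n)_{k,k+1}=c_k$ for $k=1,\dots,n-1$, and all other entries zero. The spectrum $\sigma(M)$ of a matrix $M$ is the multiset of its eigenvalues, each appearing as many times as its algebraic multiplicity. The spectrum of $J_n$ always admits the listing used in the claim (it is symmetric with respect to $0$); the numbers $\lambda_i$ need not be distinct, and for odd $n$ some of them may be zero. The symbol $\pm\sqrt{w}$ stands for the two complex square roots of $w$ (the value $0$ taken twice if $w=0$). *)

theory Defs
  imports "Jordan_Normal_Form.Char_Poly"
begin

(* Matrix rows and columns are counted from 0, whereas the sequences a and c are counted
   from 1.  The entry in (1-based) position (k+1, k) is a k, and in position (k, k+1) is c k;
   in 0-based positions this reads (k, k-1) and (k-1, k).  Only a 1, ..., a (n-1) and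
   c 1, ..., c (n-1) are used. *)
definition zero_diag_tridiag :: "nat \<Rightarrow> (nat \<Rightarrow> complex) \<Rightarrow> (nat \<Rightarrow> complex) \<Rightarrow> complex mat" where
  "zero_diag_tridiag n a c =
     mat n n (\<lambda>(i, j). if i = j + 1 then a i else if j = i + 1 then c j else 0)"

definition alt_sign_diag :: "nat \<Rightarrow> complex mat" where
  "alt_sign_diag n = mat n n (\<lambda>(i, j). if i = j then (-1) ^ i else 0)"

(* Each eigenvalue occurs with its algebraic multiplicity, that is, its order as a root of the
   characteristic polynomial.  The library's constant "spectrum" is the plain set. *)
definition spectrum_mset :: "complex mat \<Rightarrow> complex multiset" where
  "spectrum_mset A = proots (char_poly A)"

lemma count_spectrum_mset:
  assumes "A \<in> carrier_mat n n"
  shows "count (spectrum_mset A) k = order k (char_poly A)"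
proof -
  have "char_poly A \<noteq> 0"
    using degree_monic_char_poly[OF assms] by auto
  then show ?thesis
    by (simp add: spectrum_mset_def)
qed

lemma set_spectrum_mset:
  assumes "A \<in> carrier_mat n n"
  shows "set_mset (spectrum_mset A) = {k. eigenvalue A k}"
proof -
  have "char_poly A \<noteq> 0"
    using degree_monic_char_poly[OF assms] by auto
  then show ?thesis
    by (simp add: spectrum_mset_def eigenvalue_root_char_poly[OF assms])
qed

definition plus_minus :: "complex \<Rightarrow> complex multiset" where
  "plus_minus z = {# z, - z #}"

end

theory Submission
  imports Defs
begin

text \<open>
  Put \<open>u = t - x\<close> and \<open>v = t + x\<close>. Scaling rows and columns of \<open>s I - J\<close> by numbers that depend only
  on the parity of the index, one can keep the off-diagonal entries and turn the constant
  diagonal \<open>s\<close> into the alternating diagonal \<open>u, v, u, v, \<dots>\<close> of \<open>t I - A\<close>, as soon as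
  \<open>s\<^sup>2 = u v = t\<^sup>2 - x\<^sup>2\<close>. The determinant is thereby multiplied by 1 if \<open>n\<close> is even and by \<open>u / s\<close>
  if \<open>n\<close> is odd, and \<open>det (s I - J)\<close> is the product of the
  \<open>s\<^sup>2 - \<lambda>\<^sub>i\<^sup>2 = t\<^sup>2 - (\<lambda>\<^sub>i\<^sup>2 + x\<^sup>2)\<close>, times \<open>s\<close> if \<open>n\<close> is odd. This determines the
  characteristic polynomial of \<open>A\<close> at all \<open>t \<noteq> \<plusminus>x\<close>, hence everywhere.
\<close>

lemma det_scale_rows_cols:
  fixes M :: "'a :: comm_ring_1 mat"
  assumes M: "M \<in> carrier_mat n n"
  shows "det (mat n n (\<lambda>(i, j). p i * M $$ (i, j) * q j)) = (\<Prod>i<n. p i * q i) * det M"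
proof -
  have det_diag: "det (mat_diag n f) = (\<Prod>i<n. f i)" for f :: "nat \<Rightarrow> 'a"
    by (subst det_lower_triangular[of n])
       (auto simp: mat_diag_def prod_list_diag_prod atLeast0LessThan intro!: prod.cong)
  have "mat n n (\<lambda>(i, j). p i * M $$ (i, j) * q j) = mat_diag n p * M * mat_diag n q"
    using M by (subst mat_diag_mult_left[OF M], subst mat_diag_mult_right[of _ n n]) auto
  also have "det \<dots> = det (mat_diag n p) * det M * det (mat_diag n q)"
    using M by (simp add: det_mult[where n = n] mult_carrier_mat[where n = n])
  finally show ?thesis
    by (simp add: det_diag prod.distrib mult_ac)
qed

lemma prod_alternating:
  fixes r :: "'a :: field" and n :: nat
  assumes "r \<noteq> 0"
  shows "(\<Prod>i<n. if even i then r else inverse r) = (if even n then 1 else r)"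
  using assms by (induction n) auto

lemma poly_char_poly_tridiag_add_alt_sign:
  assumes s: "s\<^sup>2 = t\<^sup>2 - x\<^sup>2" "s \<noteq> 0"
  shows "poly (char_poly (zero_diag_tridiag n a c + x \<cdot>\<^sub>m alt_sign_diag n)) t
       = (if even n then 1 else (t - x) / s) * poly (char_poly (zero_diag_tridiag n a c)) s"
proof -
  let ?J = "zero_diag_tridiag n a c" and ?A = "zero_diag_tridiag n a c + x \<cdot>\<^sub>m alt_sign_diag n"
  have J: "?J \<in> carrier_mat n n" and A: "?A \<in> carrier_mat n n"
    by (auto simp: zero_diag_tridiag_def alt_sign_diag_def)
  define r where "r = (t - x) / s"
  \<comment> \<open>Even rows are scaled by \<open>r\<close>, odd columns by
    \<open>inverse r\<close>. An off-diagonal entry joins indices of opposite parity, so it receives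
    both factors or neither; a diagonal entry receives exactly one.\<close>
  define p where "p = (\<lambda>i :: nat. if even i then r else 1)"
  define q where "q = (\<lambda>i :: nat. if even i then 1 else inverse r)"
  have uv: "s * s = (t - x) * (t + x)"
    using s by (simp add: power2_eq_square algebra_simps)
  have u: "t - x \<noteq> 0"
    using uv s(2) by auto
  have r: "r \<noteq> 0" "r * s = t - x" "inverse r * s = t + x"
    using u s(2) uv by (auto simp: r_def field_simps)
  have off: "p i * z * q (Suc i) = z" "p (Suc i) * z * q i = z" for i z
    using r(1) by (auto simp: p_def q_def)
  have diag: "p i * s * q i = t - x * (- 1) ^ i" for i
    using r by (auto simp: p_def q_def mult_ac)
  have "- char_matrix ?A t = mat n n (\<lambda>(i, j). p i * (- char_matrix ?J s) $$ (i, j) * q j)"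
    by (rule eq_matI)
       (auto simp: char_matrix_def zero_diag_tridiag_def alt_sign_diag_def off[of _ "- _", simplified] off diag)
  then have "det (- char_matrix ?A t) = (\<Prod>i<n. p i * q i) * det (- char_matrix ?J s)"
    using J by (simp add: det_scale_rows_cols[of _ n])
  moreover have "(\<Prod>i<n. p i * q i) = (if even n then 1 else r)"
    using prod_alternating[OF r(1), of n]
    by (simp add: p_def q_def if_distrib cong: if_cong prod.cong)
  ultimately show ?thesis
    by (simp add: char_poly_matrix[OF J] char_poly_matrix[OF A] r_def)
qed

lemma char_poly_eq_prod_spectrum_mset:
  assumes "M \<in> carrier_mat n n"
  shows "char_poly M = (\<Prod>z\<in>#spectrum_mset M. [:- z, 1:])"
  using complex_poly_decompose_multiset[of "char_poly M"] degree_monic_char_poly[OF assms]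
  by (simp add: spectrum_mset_def)

lemma proots_prod_mset_linear:
  fixes S :: "'a :: idom multiset"
  shows "proots (\<Prod>z\<in>#S. [:- z, 1:]) = S"
proof -
  have "(\<Prod>z\<in>#S. [:- z, 1:]) \<noteq> 0" for S :: "'a multiset"
    by (auto simp: prod_mset_zero_iff)
  then show ?thesis
    by (induction S) (auto simp: proots_mult simp del: mult_pCons_left)
qed

text \<open>Each pair gives \<open>(t - f i) * (t + f i)\<close>, so only the square of
  \<open>f i\<close> matters, not the choice of root.\<close>

lemma poly_prod_plus_minus:
  "poly (\<Prod>z\<in>#(\<Sum>i\<in>I. plus_minus (f i)). [:- z, 1:]) t = (\<Prod>i\<in>I. t\<^sup>2 - (f i)\<^sup>2)"
  by (induction I rule: infinite_finite_induct)
     (auto simp: plus_minus_def power2_eq_square algebra_simps)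

lemma poly_eqI_cofinite:
  fixes p q :: "'a :: {idom, ring_char_0} poly"
  assumes "finite S" "\<And>t. t \<notin> S \<Longrightarrow> poly p t = poly q t"
  shows "p = q"
proof (rule ccontr)
  assume "p \<noteq> q"
  then have "finite {t. poly (p - q) t = 0}"
    by (intro poly_roots_finite) simp
  moreover have "UNIV \<subseteq> S \<union> {t. poly (p - q) t = 0}"
    using assms(2) by auto
  ultimately show False
    using assms(1) infinite_UNIV_char_0[where 'a = 'a] by (meson finite_Un finite_subset)
qed

theorem theorem3p1:
  fixes n l :: nat
    and a c lam :: "nat \<Rightarrow> complex"
    and x :: complex
    and J A :: "complex mat"
  assumes "n \<ge> 1"
    and "l = n div 2"
    and "\<And>k. 1 \<le> k \<Longrightarrow> k \<le> n - 1 \<Longrightarrow> a k \<noteq> 0"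
    and "\<And>k. 1 \<le> k \<Longrightarrow> k \<le> n - 1 \<Longrightarrow> c k \<noteq> 0"
    and "x \<noteq> 0"
    and "J = zero_diag_tridiag n a c"
    and "A = J + x \<cdot>\<^sub>m alt_sign_diag n"
    and "n = 2 * l \<Longrightarrow> spectrum_mset J = (\<Sum>i = 1..l. plus_minus (lam i))"
    and "n = 2 * l + 1 \<Longrightarrow> spectrum_mset J = {#0#} + (\<Sum>i = 1..l. plus_minus (lam i))"
  shows "(n = 2 * l \<longrightarrow>
            spectrum_mset A = (\<Sum>i = 1..l. plus_minus (csqrt ((lam i)\<^sup>2 + x\<^sup>2)))) \<and>
         (n = 2 * l + 1 \<longrightarrow>
            spectrum_mset A = {#x#} + (\<Sum>i = 1..l. plus_minus (csqrt ((lam i)\<^sup>2 + x\<^sup>2))))"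
proof -
  have J: "J \<in> carrier_mat n n"
    using assms(6) by (simp add: zero_diag_tridiag_def)
  \<comment> \<open>It suffices that the monic polynomial with root multiset \<open>S\<close> obeys
    the same relation to \<open>char_poly J\<close> as \<open>char_poly A\<close> does.\<close>
  have spectrum_A: "spectrum_mset A = S"
    if "\<And>t s. s\<^sup>2 = t\<^sup>2 - x\<^sup>2 \<Longrightarrow> s \<noteq> 0 \<Longrightarrow>
          poly (\<Prod>z\<in>#S. [:- z, 1:]) t
          = (if even n then 1 else (t - x) / s) * poly (\<Prod>z\<in>#spectrum_mset J. [:- z, 1:]) s"
    for S
  proof -
    have "char_poly A = (\<Prod>z\<in>#S. [:- z, 1:])"
    \<comment> \<open>At \<open>t = x\<close> and \<open>t = - x\<close> the root \<open>s\<close>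
      vanishes, so the scaling breaks down there.\<close>
    proof (rule poly_eqI_cofinite[of "{x, - x}"])
      fix t assume "t \<notin> {x, - x}"
      then have "t\<^sup>2 - x\<^sup>2 \<noteq> 0"
        by (auto simp: power2_eq_iff)
      then have s: "(csqrt (t\<^sup>2 - x\<^sup>2))\<^sup>2 = t\<^sup>2 - x\<^sup>2" "csqrt (t\<^sup>2 - x\<^sup>2) \<noteq> 0"
        by auto
      show "poly (char_poly A) t = poly (\<Prod>z\<in>#S. [:- z, 1:]) t"
        using poly_char_poly_tridiag_add_alt_sign[OF s, of n a c] that[OF s] assms(6,7)
          char_poly_eq_prod_spectrum_mset[OF J] by simp
    qed simp
    then show ?thesis
      by (simp add: spectrum_mset_def proots_prod_mset_linear)
  qed
  have shift: "t\<^sup>2 - (csqrt ((lam i)\<^sup>2 + x\<^sup>2))\<^sup>2 = s\<^sup>2 - (lam i)\<^sup>2" if "s\<^sup>2 = t\<^sup>2 - x\<^sup>2" for s t i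
    using that by simp
  show ?thesis
  proof (intro conjI impI)
    assume n: "n = 2 * l"
    show "spectrum_mset A = (\<Sum>i = 1..l. plus_minus (csqrt ((lam i)\<^sup>2 + x\<^sup>2)))"
      by (rule spectrum_A)
         (simp only: assms(8)[OF n] poly_prod_plus_minus shift, simp add: n)
  next
    assume n: "n = 2 * l + 1"
    show "spectrum_mset A = {#x#} + (\<Sum>i = 1..l. plus_minus (csqrt ((lam i)\<^sup>2 + x\<^sup>2)))"
      \<comment> \<open>The eigenvalue 0 of \<open>J\<close> contributes a factor \<open>s\<close>,
        which turns \<open>(t - x) / s\<close> into \<open>t - x\<close>, the factor of the
        eigenvalue \<open>x\<close>.\<close>
      by (rule spectrum_A)
         (simp only: assms(9)[OF n] image_mset_union prod_mset.union poly_mult poly_prod_plus_minus shift,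
          simp add: n)
  qed
qed

end
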